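(* Let $d\in\mathbb N$, $d\ge1$, let $c>0$, and let $\bm\nu\in\mathscr M_{\mathrm{loc}}(\mathbb R^d;\mathbb R^d)$ with polar decomposition $\bm\nu=\tau|\bm\nu|$. Suppose that: (i) $|\bm\nu|\left(\{x=(x_1,\dots,x_d)\in\mathbb R^d:\ x_d\le0\}\right)=0$; (ii) $\operatorname{div}\bm\nu=0$ in the sense of distributions on $\mathbb R^d$; (iii) $\tau_d(x)\ge c\,|\tau(x)|$ for $|\bm\nu|$-a.e. $x\in\mathbb R^d$, where $\tau_d$ is the $d$-th component of $\tau$. Then $\bm\nu=0$.
   Context: $\mathscr M_{\mathrm{loc}}(\mathbb R^d;\mathbb R^d)$ is the space of locally finite $\mathbb R^d$-valued Borel (Radon) measures on $\mathbb R^d$. Polar decomposition: there is a unique $\tau\in L^1_{\mathrm{loc}}(|\bm\nu|;\mathbb R^d)$ with $|\tau|=1$ $|\bm\nu|$-a.e. and $\bm\nu=\tau|\bm\nu|$, where $|\bm\nu|$ is the total variation measure. $\operatorname{div}\bm\nu=0$ means $\int\nabla\phi\cdot d\bm\nu=0$ for all $\phi\in C_c^\infty(\mathbb R^d)$. *)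

theory Defs
  imports "HOL-Analysis.Analysis"
begin

section \<open>Locally finite vector measures\<close>

abbreviation bounded_borel_sets :: "'a::euclidean_space set set" where
  "bounded_borel_sets \<equiv> {B. B \<in> sets borel \<and> bounded B}"

text \<open>A locally finite vector measure has in general no value on unbounded sets, so it is a
  function of bounded Borel sets that is countably additive within each of them. Elsewhere it is
  given the dummy value 0, so that equality of measures is equality of functions.\<close>

definition locally_finite_vector_measure ::
    "('a::euclidean_space set \<Rightarrow> 'b::euclidean_space) \<Rightarrow> bool" where
  "locally_finite_vector_measure \<nu> \<longleftrightarrow>
     (\<forall>B. B \<notin> bounded_borel_sets \<longrightarrow> \<nu> B = 0) \<and>
     (\<forall>A :: nat \<Rightarrow> 'a set. range A \<subseteq> bounded_borel_sets \<longrightarrow> disjoint_family A \<longrightarrow>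
        bounded (\<Union>i. A i) \<longrightarrow> (\<lambda>i. \<nu> (A i)) sums \<nu> (\<Union>i. A i))"

definition bounded_borel_partitions :: "'a::euclidean_space set \<Rightarrow> (nat \<Rightarrow> 'a set) set" where
  "bounded_borel_partitions B =
     {A. range A \<subseteq> bounded_borel_sets \<and> disjoint_family A \<and> (\<Union>i. A i) = B}"

definition variation_on ::
    "('a::euclidean_space set \<Rightarrow> 'b::euclidean_space) \<Rightarrow> 'a set \<Rightarrow> ennreal" where
  "variation_on \<nu> B = (SUP A \<in> bounded_borel_partitions B. \<Sum>i. ennreal (norm (\<nu> (A i))))"

text \<open>The lemma \<open>emeasure_total_variation\<close> below shows that this measure does take the values
  given by \<open>variation_on\<close>.\<close>

definition total_variation ::
    "('a::euclidean_space set \<Rightarrow> 'b::euclidean_space) \<Rightarrow> 'a measure" where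
  "total_variation \<nu> = measure_of UNIV (sets borel) (variation_on \<nu>)"

definition polar_decomposition ::
    "('a::euclidean_space set \<Rightarrow> 'b::euclidean_space) \<Rightarrow> ('a \<Rightarrow> 'b) \<Rightarrow> bool" where
  "polar_decomposition \<nu> \<tau> \<longleftrightarrow>
     \<tau> \<in> borel_measurable borel \<and>
     (\<forall>B \<in> bounded_borel_sets. set_integrable (total_variation \<nu>) B \<tau>) \<and>
     (AE x in total_variation \<nu>. norm (\<tau> x) = 1) \<and>
     (\<forall>B \<in> bounded_borel_sets. \<nu> B = (LINT x:B|total_variation \<nu>. \<tau> x))"

text \<open>The polar density is unique up to null sets, so the choice made here does not affect
  integrals against \<open>\<nu>\<close>.\<close>

definition polar_density ::
    "('a::euclidean_space set \<Rightarrow> 'b::euclidean_space) \<Rightarrow> 'a \<Rightarrow> 'b" where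
  "polar_density \<nu> = (SOME \<tau>. polar_decomposition \<nu> \<tau>)"

definition vector_integral ::
    "('a::euclidean_space set \<Rightarrow> 'b::euclidean_space) \<Rightarrow> ('a \<Rightarrow> 'b) \<Rightarrow> real" where
  "vector_integral \<nu> f = (LINT x|total_variation \<nu>. f x \<bullet> polar_density \<nu> x)"


section \<open>Test functions and the divergence\<close>

definition partial_derivative :: "'n::finite \<Rightarrow> (real ^ 'n \<Rightarrow> real) \<Rightarrow> real ^ 'n \<Rightarrow> real" where
  "partial_derivative i f x = frechet_derivative f (at x) (axis i 1)"

definition gradient :: "(real ^ 'n \<Rightarrow> real) \<Rightarrow> real ^ 'n \<Rightarrow> real ^ 'n::finite" where
  "gradient f x = (\<chi> i. partial_derivative i f x)"

fun k_times_differentiable :: "nat \<Rightarrow> (real ^ 'n::finite \<Rightarrow> real) \<Rightarrow> bool" where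
  "k_times_differentiable 0 f \<longleftrightarrow> continuous_on UNIV f"
| "k_times_differentiable (Suc k) f \<longleftrightarrow>
     f differentiable_on UNIV \<and> (\<forall>i. k_times_differentiable k (partial_derivative i f))"

definition test_function :: "(real ^ 'n::finite \<Rightarrow> real) \<Rightarrow> bool" where
  "test_function \<phi> \<longleftrightarrow>
     (\<forall>k. k_times_differentiable k \<phi>) \<and> compact (closure {x. \<phi> x \<noteq> 0})"

definition divergence_free :: "((real ^ 'n::finite) set \<Rightarrow> real ^ 'n) \<Rightarrow> bool" where
  "divergence_free \<nu> \<longleftrightarrow> (\<forall>\<phi>. test_function \<phi> \<longrightarrow> vector_integral \<nu> (gradient \<phi>) = 0)"

text \<open>The index type is linearly ordered, with elements playing the roles of \<open>1, \<dots>, d\<close>.\<close>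

abbreviation last_index :: "'n::{finite,linorder}" where
  "last_index \<equiv> Max UNIV"


section \<open>The total variation is a measure\<close>

lemma locally_finite_vector_measure_empty:
  assumes "locally_finite_vector_measure \<nu>"
  shows "\<nu> {} = 0"
proof -
  have "(\<lambda>i::nat. \<nu> {}) sums \<nu> (\<Union>i::nat. {})"
    using assms unfolding locally_finite_vector_measure_def
    by (elim conjE allE[of _ "\<lambda>i::nat. {}"]) (auto simp: disjoint_family_on_def)
  then have "summable (\<lambda>i::nat. \<nu> {})" by (auto simp: sums_iff)
  then show ?thesis by (simp add: summable_const_iff)
qed

lemma variation_on_upper:
  "A \<in> bounded_borel_partitions B \<Longrightarrow> (\<Sum>i. ennreal (norm (\<nu> (A i)))) \<le> variation_on \<nu> B"
  unfolding variation_on_def by (rule SUP_upper)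

lemma bounded_borel_partitions_nonempty:
  assumes "B \<in> sets (borel :: 'a::euclidean_space measure)"
  shows "bounded_borel_partitions B \<noteq> {}"
proof -
  let ?A = "\<lambda>i. B \<inter> disjointed (\<lambda>n. ball (0::'a) (real n)) i"
  have bd: "disjointed (\<lambda>n. ball (0::'a) (real n)) i \<subseteq> ball 0 (real i)" for i
    by (rule disjointed_subset)
  have "(\<Union>n. ball (0::'a) (real n)) = UNIV"
    by (auto simp: reals_Archimedean2)
  then have "(\<Union>i. ?A i) = B"
    by (simp flip: Int_UN_distrib add: UN_disjointed_eq)
  moreover have "disjoint_family ?A"
    using disjoint_family_disjointed[of "\<lambda>n. ball (0::'a) (real n)"]
    by (auto simp: disjoint_family_on_def)
  moreover have "?A i \<in> sets borel" for i
  proof -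
    have "range (disjointed (\<lambda>n. ball (0::'a) (real n))) \<subseteq> sets borel"
      by (rule sets.range_disjointed_sets) auto
    then show ?thesis using assms by auto
  qed
  moreover have "bounded (?A i)" for i
    using bd[of i] by (meson bounded_ball bounded_subset inf.coboundedI2)
  ultimately show ?thesis by (auto simp: bounded_borel_partitions_def)
qed

lemma variation_on_empty:
  assumes "locally_finite_vector_measure \<nu>"
  shows "variation_on \<nu> {} = 0"
proof -
  have "variation_on \<nu> {} \<le> 0"
    unfolding variation_on_def
  proof (rule SUP_least)
    fix A :: "nat \<Rightarrow> 'a set" assume "A \<in> bounded_borel_partitions {}"
    then have "\<And>i. A i = {}" by (auto simp: bounded_borel_partitions_def)
    then show "(\<Sum>i. ennreal (norm (\<nu> (A i)))) \<le> 0"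
      using locally_finite_vector_measure_empty[OF assms] by simp
  qed
  then show ?thesis by simp
qed

lemma variation_on_superadditive:
  assumes \<nu>: "locally_finite_vector_measure \<nu>"
    and B: "B \<in> sets borel" and C: "C \<in> sets borel" and disj: "B \<inter> C = {}"
  shows "variation_on \<nu> B + variation_on \<nu> C \<le> variation_on \<nu> (B \<union> C)"
proof -
  note ne = bounded_borel_partitions_nonempty[OF B] bounded_borel_partitions_nonempty[OF C]
  have key: "(\<Sum>i. ennreal (norm (\<nu> (P i)))) + (\<Sum>i. ennreal (norm (\<nu> (Q i))))
        \<le> variation_on \<nu> (B \<union> C)"
    if P: "P \<in> bounded_borel_partitions B" and Q: "Q \<in> bounded_borel_partitions C" for P Q
  proof -
    define R where "R = (\<lambda>(i::nat, j). if i = 0 then P j else if i = 1 then Q j else {})"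
    have R_disj: "R p \<inter> R q = {}" if "p \<noteq> q" for p q
    proof -
      have "P i \<subseteq> B" "Q i \<subseteq> C" for i
        using P Q by (auto simp: bounded_borel_partitions_def)
      moreover have "i \<noteq> j \<Longrightarrow> P i \<inter> P j = {}" "i \<noteq> j \<Longrightarrow> Q i \<inter> Q j = {}" for i j
        using P Q by (auto simp: bounded_borel_partitions_def disjoint_family_on_def)
      ultimately show ?thesis
        using disj that unfolding R_def
        by (cases p; cases q) (simp, blast)
    qed
    have "(\<lambda>n. R (prod_decode n)) \<in> bounded_borel_partitions (B \<union> C)"
      unfolding bounded_borel_partitions_def
    proof (intro CollectI conjI)
      have "P i \<in> bounded_borel_sets" "Q i \<in> bounded_borel_sets" for i
        using P Q unfolding bounded_borel_partitions_def by blast+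
      then have "R p \<in> bounded_borel_sets" for p
        unfolding R_def by (cases p) simp
      then show "range (\<lambda>n. R (prod_decode n)) \<subseteq> bounded_borel_sets"
        by blast
      show "disjoint_family (\<lambda>n. R (prod_decode n))"
        unfolding disjoint_family_on_def
        by (intro ballI impI R_disj) (simp add: inj_prod_decode inj_eq)
      have "(\<Union>n. R (prod_decode n)) = (\<Union>p. R p)"
        using surj_prod_decode by (simp flip: image_image)
      also have "\<dots> = (\<Union>i. P i) \<union> (\<Union>i. Q i)"
      proof (intro equalityI subsetI)
        fix x assume "x \<in> (\<Union>p. R p)"
        then show "x \<in> (\<Union>i. P i) \<union> (\<Union>i. Q i)"
          by (auto simp: R_def split: if_splits)
      next
        fix x assume "x \<in> (\<Union>i. P i) \<union> (\<Union>i. Q i)"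
        then obtain j where "x \<in> R (0, j) \<or> x \<in> R (1, j)" by (auto simp: R_def)
        then show "x \<in> (\<Union>p. R p)" by blast
      qed
      finally show "(\<Union>n. R (prod_decode n)) = B \<union> C"
        using P Q by (simp add: bounded_borel_partitions_def)
    qed
    then have le: "(\<Sum>n. ennreal (norm (\<nu> (R (prod_decode n))))) \<le> variation_on \<nu> (B \<union> C)"
      by (rule variation_on_upper)
    have "(\<Sum>n. ennreal (norm (\<nu> (R (prod_decode n)))))
        = (\<Sum>i. \<Sum>j. ennreal (norm (\<nu> (R (i, j)))))"
      by (rule suminf_ennreal_2dimen) simp
    also have "\<dots> = (\<Sum>i\<in>{0, 1}. \<Sum>j. ennreal (norm (\<nu> (R (i, j)))))"
      using locally_finite_vector_measure_empty[OF \<nu>]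
      by (intro suminf_finite) (auto simp: R_def)
    also have "\<dots> = (\<Sum>i. ennreal (norm (\<nu> (P i)))) + (\<Sum>i. ennreal (norm (\<nu> (Q i))))"
      by (simp add: R_def)
    finally show ?thesis using le by simp
  qed
  have "(\<Sum>i. ennreal (norm (\<nu> (P i)))) + variation_on \<nu> C \<le> variation_on \<nu> (B \<union> C)"
    if "P \<in> bounded_borel_partitions B" for P
    unfolding variation_on_def[of \<nu> C]
    by (subst ennreal_SUP_add_right[OF ne(2)]) (intro SUP_least key that)
  then show ?thesis
    unfolding variation_on_def[of \<nu> B]
    by (subst ennreal_SUP_add_left[OF ne(1), symmetric]) (intro SUP_least)
qed

lemma variation_on_countably_additive:
  fixes \<nu> :: "'a::euclidean_space set \<Rightarrow> 'b::euclidean_space"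
  assumes \<nu>: "locally_finite_vector_measure \<nu>"
  shows "countably_additive (sets borel) (variation_on \<nu>)"
proof (rule countably_additiveI)
  fix E :: "nat \<Rightarrow> 'a set"
  assume E: "range E \<subseteq> sets borel" and disj: "disjoint_family E"
  show "(\<Sum>i. variation_on \<nu> (E i)) = variation_on \<nu> (\<Union>i. E i)"
  proof (rule antisym)
    have fin: "(\<Sum>i<n. variation_on \<nu> (E i)) \<le> variation_on \<nu> (\<Union>i<n. E i)" for n
    proof (induction n)
      case 0
      then show ?case by simp
    next
      case (Suc n)
      have "(\<Sum>i<Suc n. variation_on \<nu> (E i))
          \<le> variation_on \<nu> (\<Union>i<n. E i) + variation_on \<nu> (E n)"
        using Suc.IH by (simp add: add_right_mono)
      also have "\<dots> \<le> variation_on \<nu> ((\<Union>i<n. E i) \<union> E n)"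
      proof (rule variation_on_superadditive[OF \<nu>])
        show "(\<Union>i<n. E i) \<in> sets borel" "E n \<in> sets borel"
          using E by auto
        have "E i \<inter> E n = {}" if "i < n" for i
          using disj that by (auto simp: disjoint_family_on_def)
        then show "(\<Union>i<n. E i) \<inter> E n = {}" by blast
      qed
      also have "(\<Union>i<n. E i) \<union> E n = (\<Union>i<Suc n. E i)"
        by (auto simp: lessThan_Suc)
      finally show ?case .
    qed
    have "variation_on \<nu> (\<Union>i<n. E i) \<le> variation_on \<nu> (\<Union>i. E i)" for n
    proof -
      have UN: "(\<Union>i. E i) \<in> sets borel" "(\<Union>i<n. E i) \<in> sets borel"
        using E by auto
      have "variation_on \<nu> (\<Union>i<n. E i) + variation_on \<nu> ((\<Union>i. E i) - (\<Union>i<n. E i))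
          \<le> variation_on \<nu> ((\<Union>i<n. E i) \<union> ((\<Union>i. E i) - (\<Union>i<n. E i)))"
        using UN by (intro variation_on_superadditive[OF \<nu>]) auto
      also have "(\<Union>i<n. E i) \<union> ((\<Union>i. E i) - (\<Union>i<n. E i)) = (\<Union>i. E i)" by blast
      finally have "variation_on \<nu> (\<Union>i<n. E i) + variation_on \<nu> ((\<Union>i. E i) - (\<Union>i<n. E i))
          \<le> variation_on \<nu> (\<Union>i. E i)" .
      then show ?thesis
        by (rule order_trans[rotated]) (simp add: add_increasing2)
    qed
    then show "(\<Sum>i. variation_on \<nu> (E i)) \<le> variation_on \<nu> (\<Union>i. E i)"
      unfolding suminf_eq_SUP by (intro SUP_least) (blast intro: order_trans fin)
  next
    show "variation_on \<nu> (\<Union>i. E i) \<le> (\<Sum>i. variation_on \<nu> (E i))"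
      unfolding variation_on_def[of \<nu> "\<Union>i. E i"]
    proof (rule SUP_least)
      fix A assume A: "A \<in> bounded_borel_partitions (\<Union>i. E i)"
      have A_bb: "A j \<in> sets borel" "bounded (A j)" for j
        using A by (auto simp: bounded_borel_partitions_def)
      have le: "ennreal (norm (\<nu> (A j))) \<le> (\<Sum>i. ennreal (norm (\<nu> (A j \<inter> E i))))" for j
      proof -
        let ?F = "\<lambda>i. A j \<inter> E i"
        have UN: "(\<Union>i. ?F i) = A j"
          using A by (auto simp: bounded_borel_partitions_def)
        have "(\<lambda>i. \<nu> (?F i)) sums \<nu> (\<Union>i. ?F i)"
        proof -
          have "range ?F \<subseteq> bounded_borel_sets"
            using A_bb E by (auto intro: bounded_subset)
          moreover have "disjoint_family ?F"
            using disj by (auto simp: disjoint_family_on_def)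
          moreover have "bounded (\<Union>i. ?F i)"
            using UN A_bb by simp
          ultimately show ?thesis
            using \<nu> unfolding locally_finite_vector_measure_def by blast
        qed
        then have s: "\<nu> (A j) = (\<Sum>i. \<nu> (?F i))"
          by (simp only: UN sums_iff)
        show ?thesis
        proof (cases "(\<Sum>i. ennreal (norm (\<nu> (?F i)))) = top")
          case False
          then have "summable (\<lambda>i. norm (\<nu> (?F i)))"
            by (intro summable_suminf_not_top) auto
          then show ?thesis
            using summable_norm[of "\<lambda>i. \<nu> (?F i)"] s
            by (simp add: suminf_ennreal2 ennreal_leI)
        qed simp
      qed
      have "(\<Sum>j. ennreal (norm (\<nu> (A j)))) \<le> (\<Sum>j. \<Sum>i. ennreal (norm (\<nu> (A j \<inter> E i))))"
        by (intro suminf_le le) auto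
      also have "\<dots> = (\<Sum>i. \<Sum>j. ennreal (norm (\<nu> (A j \<inter> E i))))"
        unfolding nn_integral_count_space_nat[symmetric, of "\<lambda>j. ennreal (norm (\<nu> (A j \<inter> E i)))" for i]
          nn_integral_count_space_nat[symmetric, of "\<lambda>j. \<Sum>i. ennreal (norm (\<nu> (A j \<inter> E i)))"]
        by (rule nn_integral_suminf) simp
      also have "\<dots> \<le> (\<Sum>i. variation_on \<nu> (E i))"
      proof (intro suminf_le variation_on_upper)
        fix i
        show "(\<lambda>j. A j \<inter> E i) \<in> bounded_borel_partitions (E i)"
          unfolding bounded_borel_partitions_def
        proof (intro CollectI conjI)
          show "range (\<lambda>j. A j \<inter> E i) \<subseteq> bounded_borel_sets"
            using A_bb E by (auto intro!: sets.Int intro: bounded_Int)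
          show "disjoint_family (\<lambda>j. A j \<inter> E i)"
            using A by (auto simp: bounded_borel_partitions_def disjoint_family_on_def)
          have "(\<Union>j. A j) = (\<Union>i. E i)"
            using A by (simp add: bounded_borel_partitions_def)
          then show "(\<Union>j. A j \<inter> E i) = E i" by blast
        qed
      qed auto
      finally show "(\<Sum>j. ennreal (norm (\<nu> (A j)))) \<le> (\<Sum>i. variation_on \<nu> (E i))" .
    qed
  qed
qed

lemma sets_total_variation [simp]: "sets (total_variation \<nu>) = sets borel"
  and space_total_variation [simp]: "space (total_variation \<nu>) = UNIV"
  unfolding total_variation_def using sets.sigma_sets_eq[of borel] by simp_all

lemma emeasure_total_variation:
  assumes "locally_finite_vector_measure \<nu>" and "B \<in> sets borel"
  shows "emeasure (total_variation \<nu>) B = variation_on \<nu> B"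
  using assms variation_on_countably_additive[OF assms(1)] variation_on_empty[OF assms(1)]
  by (intro emeasure_measure_of[OF total_variation_def]) (auto simp: positive_def)

end

theory Submission
  imports Defs "HOL-Computational_Algebra.Polynomial"
begin

text \<open>
  The test function is a radial bump \<open>\<phi>(x) = f(s - |x - a|\<^sup>2)\<close>, with \<open>f(u) = exp(-1/u)\<close>
  for \<open>u > 0\<close>, centred at a point \<open>a\<close> far below the half-space where \<open>\<nu>\<close> lives. On the cap that
  its support cuts out of the half-space, every direction of the cone condition has positive
  inner product with \<open>x - a\<close>, so \<open>\<phi>\<close> strictly decreases along \<open>\<tau>\<close>. As \<open>\<integral>\<nabla>\<phi> \<cdot> d\<nu> = 0\<close>, the cap
  is a null set, and suitable caps exhaust the half-space.
\<close>

section \<open>Flat functions\<close>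

text \<open>The polynomial is a parameter because every derivative of exp(-1/u) is a polynomial in
  1/u times exp(-1/u); the choice \<open>p = 1\<close> is the starting function.\<close>

definition flat_exp :: "real poly \<Rightarrow> real \<Rightarrow> real" where
  "flat_exp p u = (if u > 0 then poly p (1 / u) / exp (1 / u) else 0)"

lemma poly_div_exp_tendsto_0: "((\<lambda>y. poly p y / exp y) \<longlongrightarrow> (0::real)) at_top"
proof -
  have "((\<lambda>y::real. \<Sum>i\<le>degree p. coeff p i * (y ^ i / exp y)) \<longlongrightarrow> (\<Sum>i\<le>degree p. coeff p i * 0)) at_top"
    by (intro tendsto_intros tendsto_power_div_exp_0)
  then show ?thesis
    by (simp add: poly_altdef sum_divide_distrib)
qed

lemma flat_exp_tendsto_0: "(flat_exp p \<longlongrightarrow> 0) (at 0)"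
proof -
  have "((\<lambda>u::real. poly p (1 / u) / exp (1 / u)) \<longlongrightarrow> 0) (at_right 0)"
    using filterlim_compose[OF poly_div_exp_tendsto_0 filterlim_inverse_at_top_right]
    by (simp add: inverse_eq_divide)
  then have "(flat_exp p \<longlongrightarrow> 0) (at_right 0)"
    by (rule Lim_transform_eventually)
      (auto simp: flat_exp_def intro: eventually_mono[OF eventually_at_right_less])
  moreover have "(flat_exp p \<longlongrightarrow> 0) (at_left 0)"
    by (rule Lim_transform_eventually[OF tendsto_const])
      (auto simp: flat_exp_def eventually_at_left_field intro: exI[of _ "-1"])
  ultimately show ?thesis by (simp add: filterlim_split_at)
qed

text \<open>With y = 1/u one has d/du = - y^2 d/dy, so p(y) exp(-y) turns into y^2 (p - p')(y)
  exp(-y); the factor \<open>[:0, 0, 1:]\<close> is y^2.\<close>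

lemma has_field_derivative_flat_exp:
  "(flat_exp p has_field_derivative flat_exp ([:0, 0, 1:] * (p - pderiv p)) u) (at u)"
proof -
  consider "u > 0" | "u < 0" | "u = 0" by linarith
  then show ?thesis
  proof cases
    case 1
    have "((\<lambda>u. poly p (1 / u) / exp (1 / u)) has_field_derivative
        flat_exp ([:0, 0, 1:] * (p - pderiv p)) u) (at u)"
      using 1 by (auto intro!: derivative_eq_intros DERIV_chain2[OF poly_DERIV]
          simp: flat_exp_def field_simps power2_eq_square)
    then show ?thesis
      by (rule has_field_derivative_transform_within_open[of _ _ _ "{0<..}"])
        (use 1 in \<open>auto simp: flat_exp_def\<close>)
  next
    case 2
    have "((\<lambda>_. 0) has_field_derivative flat_exp ([:0, 0, 1:] * (p - pderiv p)) u) (at u)"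
      using 2 by (simp add: flat_exp_def)
    then show ?thesis
      by (rule has_field_derivative_transform_within_open[of _ _ _ "{..<0}"])
        (use 2 in \<open>auto simp: flat_exp_def\<close>)
  next
    case 3
    \<comment> \<open>Dividing by h multiplies the polynomial by its variable 1/h, so the difference
      quotient at 0 is again flat and tends to 0.\<close>
    have "(flat_exp p (0 + h) - flat_exp p 0) / h = flat_exp (pCons 0 p) h" for h
      by (simp add: flat_exp_def)
    with 3 show ?thesis
      using flat_exp_tendsto_0[of "pCons 0 p"] by (simp add: DERIV_def flat_exp_def[of _ 0])
  qed
qed

section \<open>Smooth bumps on balls\<close>

lemma partial_derivativeI:
  assumes "(f has_derivative f') (at x)"
  shows "partial_derivative i f x = f' (axis i 1)"
  using frechet_derivative_at[OF assms] by (simp add: partial_derivative_def)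

text \<open>Reduces smoothness of all orders to first derivatives: it is enough to find one class
  that contains the function and is stable under them.\<close>

lemma k_times_differentiable_closed_class:
  assumes "\<And>f. f \<in> S \<Longrightarrow> f differentiable_on UNIV"
    and "\<And>f i. f \<in> S \<Longrightarrow> partial_derivative i f \<in> S"
    and "f \<in> S"
  shows "k_times_differentiable k f"
  using assms(3)
proof (induction k arbitrary: f)
  case 0
  then show ?case by (simp add: assms(1) differentiable_imp_continuous_on)
next
  case (Suc k)
  then show ?case using assms(1,2) by auto
qed

text \<open>Using the squared distance keeps the inner function polynomial, hence smooth at the
  centre as well.\<close>

definition ball_bump :: "real poly \<Rightarrow> 'a::real_inner \<Rightarrow> real \<Rightarrow> 'a \<Rightarrow> real" where
  "ball_bump p a s x = flat_exp p (s - (x - a) \<bullet> (x - a))"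

lemma has_derivative_ball_bump:
  "(ball_bump p a s has_derivative
     (\<lambda>h. ball_bump ([:0, 0, 1:] * (p - pderiv p)) a s x * (- 2 * ((x - a) \<bullet> h)))) (at x)"
proof -
  have "((\<lambda>x. s - (x - a) \<bullet> (x - a)) has_derivative (\<lambda>h. - 2 * ((x - a) \<bullet> h))) (at x)"
    by (auto intro!: derivative_eq_intros simp: inner_commute)
  then show ?thesis
    unfolding ball_bump_def[abs_def]
    by (rule has_derivative_compose)
      (use has_field_derivative_flat_exp in \<open>unfold has_field_derivative_def\<close>)
qed

text \<open>Closed under partial derivatives, which yields smoothness without a Leibniz rule of
  higher order.\<close>

inductive_set bump_algebra :: "real ^ 'n::finite \<Rightarrow> real \<Rightarrow> (real ^ 'n \<Rightarrow> real) set"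
  for a s where
  const: "(\<lambda>x. b) \<in> bump_algebra a s"
| component: "(\<lambda>x. x $ i) \<in> bump_algebra a s"
| bump: "ball_bump p a s \<in> bump_algebra a s"
| add: "f \<in> bump_algebra a s \<Longrightarrow> g \<in> bump_algebra a s \<Longrightarrow> (\<lambda>x. f x + g x) \<in> bump_algebra a s"
| mult: "f \<in> bump_algebra a s \<Longrightarrow> g \<in> bump_algebra a s \<Longrightarrow> (\<lambda>x. f x * g x) \<in> bump_algebra a s"

lemma bump_algebra_derivative:
  assumes "f \<in> bump_algebra a s"
  shows "f differentiable_on UNIV \<and> (\<forall>i. partial_derivative i f \<in> bump_algebra a s)"
  using assms
proof induction
  case (const b)
  have "partial_derivative i (\<lambda>x. b) = (\<lambda>x. 0)" for i :: 'a
    by (intro ext partial_derivativeI[THEN trans]) (auto intro: has_derivative_const)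
  then show ?case by (auto intro: bump_algebra.const)
next
  case (component j)
  have d: "((\<lambda>x. x $ j) has_derivative (\<lambda>h. h $ j)) (at x)" for x :: "real ^ 'a"
    by (intro bounded_linear_imp_has_derivative bounded_linear_vec_nth)
  have "partial_derivative i (\<lambda>x. x $ j) = (\<lambda>x. axis i 1 $ j)" for i :: 'a
    by (intro ext partial_derivativeI[OF d])
  then show ?case using d
    by (auto intro: bump_algebra.const simp: differentiable_on_def differentiable_def)
next
  case (bump p)
  \<comment> \<open>A bump differentiates to another bump times an affine function. The difference
    is written as a sum because the closure rules offer sums and products only.\<close>
  have "partial_derivative i (ball_bump p a s) =
      (\<lambda>x. ball_bump ([:0, 0, 1:] * (p - pderiv p)) a s x * (- 2 * (x $ i + - a $ i)))" for i
    by (rule ext, subst partial_derivativeI[OF has_derivative_ball_bump])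
      (simp add: inner_axis)
  then show ?case using has_derivative_ball_bump[of p a s]
    by (auto intro!: bump_algebra.intros simp only: differentiable_on_def differentiable_def)
next
  case (add f g)
  then have fg: "(f has_derivative frechet_derivative f (at x)) (at x)"
    "(g has_derivative frechet_derivative g (at x)) (at x)" for x
    by (auto simp: differentiable_on_def frechet_derivative_works)
  have "partial_derivative i (\<lambda>x. f x + g x) =
      (\<lambda>x. partial_derivative i f x + partial_derivative i g x)" for i
    by (rule ext, subst partial_derivativeI[OF has_derivative_add[OF fg]])
      (simp add: partial_derivative_def)
  then show ?case using add
    by (auto intro!: bump_algebra.add differentiable_on_add)
next
  case (mult f g)
  then have fg: "(f has_derivative frechet_derivative f (at x)) (at x)"
    "(g has_derivative frechet_derivative g (at x)) (at x)" for x
    by (auto simp: differentiable_on_def frechet_derivative_works)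
  have "partial_derivative i (\<lambda>x. f x * g x) =
      (\<lambda>x. f x * partial_derivative i g x + partial_derivative i f x * g x)" for i
    by (rule ext, subst partial_derivativeI[OF has_derivative_mult[OF fg]])
      (simp add: partial_derivative_def)
  then show ?case using mult
    by (auto intro!: bump_algebra.add bump_algebra.mult differentiable_on_mult)
qed

lemma ball_bump_eq_0: "norm (x - a) ^ 2 \<ge> s \<Longrightarrow> ball_bump p a s x = 0"
  by (simp add: ball_bump_def flat_exp_def dot_square_norm)

lemma ball_bump_eq_0_outside_cball: "x \<notin> cball a (sqrt s) \<Longrightarrow> ball_bump p a s x = 0"
proof (rule ball_bump_eq_0)
  assume "x \<notin> cball a (sqrt s)"
  then have "sqrt s \<le> norm (x - a)" by (simp add: dist_norm norm_minus_commute)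
  then show "s \<le> norm (x - a) ^ 2" by (rule sqrt_le_D)
qed

lemma test_function_ball_bump: "test_function (ball_bump p a s)"
  unfolding test_function_def
proof
  show "\<forall>k. k_times_differentiable k (ball_bump p a s)"
    using k_times_differentiable_closed_class[of "bump_algebra a s"] bump_algebra_derivative
      bump_algebra.bump by blast
  have "{x. ball_bump p a s x \<noteq> 0} \<subseteq> cball a (sqrt s)"
    using ball_bump_eq_0_outside_cball by blast
  then show "compact (closure {x. ball_bump p a s x \<noteq> 0})"
    by (meson bounded_cball bounded_subset compact_closure)
qed

lemma gradient_ball_bump:
  "gradient (ball_bump p a s) x =
     (- 2 * ball_bump ([:0, 0, 1:] * (p - pderiv p)) a s x) *\<^sub>R (x - a)"
  by (simp add: gradient_def vec_eq_iff partial_derivativeI[OF has_derivative_ball_bump] inner_axis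
      algebra_simps del: mult_pCons_left)

lemma continuous_on_ball_bump: "continuous_on A (ball_bump p a s)"
  by (intro continuous_at_imp_continuous_on ballI has_derivative_continuous[OF has_derivative_ball_bump])


section \<open>Polar decompositions\<close>

text \<open>Carries the cone condition from a given density to the chosen one inside
  \<open>vector_integral\<close>. On a bounded set where \<sigma> violates the bound, both densities
  have the same integral, so the difference of their components, positive there, integrates to 0;
  the set is null.\<close>

lemma polar_decomposition_component_lower_bound:
  fixes \<nu> :: "(real ^ 'n::finite) set \<Rightarrow> real ^ 'm::finite"
  assumes \<tau>: "polar_decomposition \<nu> \<tau>" and \<sigma>: "polar_decomposition \<nu> \<sigma>"
    and ge: "AE x in total_variation \<nu>. c \<le> \<tau> x $ k"
  shows "AE x in total_variation \<nu>. c \<le> \<sigma> x $ k"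
proof -
  let ?M = "total_variation \<nu>"
  have [measurable]: "\<sigma> \<in> borel_measurable borel" "\<tau> \<in> borel_measurable borel"
    using \<sigma> \<tau> by (auto simp: polar_decomposition_def)
  \<comment> \<open>The violating set is cut into bounded pieces, since densities represent \<nu> on
    bounded Borel sets only.\<close>
  have "AE x in ?M. x \<notin> {x \<in> ball 0 (real n). \<sigma> x $ k < c}" for n
  proof -
    define B where "B = {x \<in> ball 0 (real n). \<sigma> x $ k < c}"
    have B: "B \<in> bounded_borel_sets"
      unfolding B_def
      using bounded_subset[OF bounded_ball, of _ "0 :: real ^ 'n" "real n"] by (auto simp: subset_iff)
    define h where "h = (\<lambda>x. indicat_real B x * (\<tau> x $ k - \<sigma> x $ k))"
    have int: "set_integrable ?M B \<tau>" "set_integrable ?M B \<sigma>"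
      and eq: "(LINT x:B|?M. \<tau> x) = (LINT x:B|?M. \<sigma> x)"
      using \<tau> \<sigma> B by (auto simp: polar_decomposition_def)
    have int': "integrable ?M (\<lambda>x. indicat_real B x *\<^sub>R \<tau> x - indicat_real B x *\<^sub>R \<sigma> x)"
      using int unfolding set_integrable_def by (rule Bochner_Integration.integrable_diff)
    have h: "h = (\<lambda>x. (indicat_real B x *\<^sub>R \<tau> x - indicat_real B x *\<^sub>R \<sigma> x) $ k)"
      by (simp add: h_def algebra_simps)
    have "integrable ?M h"
      unfolding h by (rule integrable_bounded_linear[OF bounded_linear_vec_nth int'])
    moreover have "AE x in ?M. 0 \<le> h x"
      using ge by eventually_elim (auto simp: h_def B_def indicator_def)
    moreover have "integral\<^sup>L ?M h = 0"
      unfolding h integral_bounded_linear[OF bounded_linear_vec_nth int']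
      using eq int unfolding set_integrable_def set_lebesgue_integral_def
      by (simp add: Bochner_Integration.integral_diff)
    ultimately have "AE x in ?M. h x = 0"
      using integral_nonneg_eq_0_iff_AE by blast
    with ge show ?thesis
      unfolding B_def[symmetric]
      by eventually_elim (auto simp: h_def B_def indicator_def)
  qed
  then have "AE x in ?M. \<forall>n. x \<notin> {x \<in> ball 0 (real n). \<sigma> x $ k < c}"
    by (subst AE_all_countable) blast
  then show ?thesis
  proof eventually_elim
    case (elim x)
    obtain n where "norm x < real n" using reals_Archimedean2 by blast
    moreover have "x \<notin> {x \<in> ball 0 (real n). \<sigma> x $ k < c}" using elim by blast
    ultimately show ?case by (simp add: not_less)
  qed
qed

text \<open>That \<open>False\<close> holds almost everywhere says that the whole space is a null
  set.\<close>

lemma polar_decomposition_eq_0: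
  assumes "locally_finite_vector_measure \<nu>" and "polar_decomposition \<nu> \<tau>"
    and "AE x in total_variation \<nu>. False"
  shows "\<nu> = (\<lambda>B. 0)"
proof
  fix B
  show "\<nu> B = 0"
  proof (cases "B \<in> bounded_borel_sets")
    case True
    then have "\<nu> B = (LINT x:B|total_variation \<nu>. \<tau> x)"
      using assms(2) by (auto simp: polar_decomposition_def)
    also have "\<dots> = 0"
      unfolding set_lebesgue_integral_def using assms(3) by (intro integral_eq_zero_AE) auto
    finally show ?thesis .
  next
    case False
    then show ?thesis using assms(1) by (auto simp: locally_finite_vector_measure_def)
  qed
qed

text \<open>Testing with a bump on the ball gives the gradient - 2 \<psi>(x) (x - a), where \<psi>
  is positive inside the ball and zero outside. Paired with \<sigma> it has one sign and integral 0,
  so it vanishes almost everywhere, which the strict inequality excludes inside the ball.\<close>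

lemma divergence_free_AE_not_in_ball:
  fixes \<nu> :: "(real ^ 'n::finite) set \<Rightarrow> real ^ 'n" and \<sigma> :: "real ^ 'n \<Rightarrow> real ^ 'n"
  defines "\<sigma> \<equiv> polar_density \<nu>"
  assumes \<sigma>: "polar_decomposition \<nu> \<sigma>" and div: "divergence_free \<nu>"
    and pos: "AE x in total_variation \<nu>. x \<in> ball a r \<longrightarrow> (x - a) \<bullet> \<sigma> x > 0"
  shows "AE x in total_variation \<nu>. x \<notin> ball a r"
proof (cases "r > 0")
  case r: True
  let ?M = "total_variation \<nu>"
  \<comment> \<open>This is f'(r^2 - |x - a|^2) for f(u) = exp(-1/u): the derivative rule sends the
    polynomial 1 to \<open>[:0, 0, 1:]\<close>.\<close>
  define \<psi> where "\<psi> = ball_bump [:0, 0, 1:] a (r\<^sup>2)"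
  define f where "f = (\<lambda>x. 2 * \<psi> x * ((x - a) \<bullet> \<sigma> x))"
  have [measurable]: "\<sigma> \<in> borel_measurable borel"
    using \<sigma> by (auto simp: polar_decomposition_def)
  have [measurable]: "\<psi> \<in> borel_measurable borel"
    unfolding \<psi>_def by (intro borel_measurable_continuous_onI continuous_on_ball_bump)
  have f_eq: "f x = - (gradient (ball_bump 1 a (r\<^sup>2)) x \<bullet> \<sigma> x)" for x
    by (simp add: f_def \<psi>_def gradient_ball_bump)
  have \<psi>_out: "\<psi> x = 0" if "x \<notin> ball a r" for x
    unfolding \<psi>_def
    by (rule ball_bump_eq_0) (use that r in \<open>auto simp: dist_norm norm_minus_commute intro!: power_mono\<close>)
  have \<psi>_in: "\<psi> x > 0" if "x \<in> ball a r" for x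
  proof -
    have "(norm (x - a))\<^sup>2 < r\<^sup>2"
      using that by (intro power_strict_mono) (auto simp: dist_norm norm_minus_commute)
    then show ?thesis
      by (simp add: \<psi>_def ball_bump_def flat_exp_def dot_square_norm)
  qed
  \<comment> \<open>Since \<sigma> is known to be integrable on bounded sets only, \<open>f\<close>
    is dominated by K |\<sigma>| on the closed ball and vanishes outside it.\<close>
  have "bounded ((\<lambda>x. (2 * \<psi> x) *\<^sub>R (x - a)) ` cball a r)"
    unfolding \<psi>_def
    by (intro compact_imp_bounded compact_continuous_image continuous_intros continuous_on_ball_bump) auto
  then obtain K where K: "\<And>x. x \<in> cball a r \<Longrightarrow> norm ((2 * \<psi> x) *\<^sub>R (x - a)) \<le> K"
    unfolding bounded_iff by blast
  have K0: "0 \<le> K" using K[of a] r by simp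
  have "integrable ?M f"
  proof (rule Bochner_Integration.integrable_bound)
    have "cball a r \<in> bounded_borel_sets" by simp
    then have "set_integrable ?M (cball a r) \<sigma>"
      using \<sigma> unfolding polar_decomposition_def by blast
    then show "integrable ?M (\<lambda>x. K *\<^sub>R (indicat_real (cball a r) x *\<^sub>R \<sigma> x))"
      unfolding set_integrable_def by (rule integrable_scaleR_right)
    have "f \<in> borel_measurable borel" unfolding f_def by measurable
    then show "f \<in> borel_measurable ?M"
      by (simp cong: measurable_cong_sets)
    have "norm (f x) \<le> norm (K *\<^sub>R (indicat_real (cball a r) x *\<^sub>R \<sigma> x))" for x
    proof (cases "x \<in> cball a r")
      case True
      have "norm (f x) = \<bar>((2 * \<psi> x) *\<^sub>R (x - a)) \<bullet> \<sigma> x\<bar>" by (simp add: f_def)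
      also have "\<dots> \<le> norm ((2 * \<psi> x) *\<^sub>R (x - a)) * norm (\<sigma> x)"
        by (rule Cauchy_Schwarz_ineq2)
      also have "\<dots> \<le> K * norm (\<sigma> x)"
        by (intro mult_right_mono K True) auto
      finally show ?thesis using True K0 by simp
    next
      case False
      then have "x \<notin> ball a r" by auto
      then show ?thesis using \<psi>_out by (simp add: f_def)
    qed
    then show "AE x in ?M. norm (f x) \<le> norm (K *\<^sub>R (indicat_real (cball a r) x *\<^sub>R \<sigma> x))"
      by simp
  qed
  moreover have "AE x in ?M. 0 \<le> f x"
    using pos
  proof eventually_elim
    case (elim x)
    then show ?case
      using \<psi>_in[of x] \<psi>_out[of x] by (cases "x \<in> ball a r") (simp_all add: f_def)
  qed
  moreover have "integral\<^sup>L ?M f = 0"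
    using div test_function_ball_bump[of 1 a "r\<^sup>2"]
    by (simp add: f_eq[abs_def] divergence_free_def vector_integral_def \<sigma>_def)
  ultimately have "AE x in ?M. f x = 0"
    using integral_nonneg_eq_0_iff_AE by blast
  with pos show ?thesis
  proof eventually_elim
    case (elim x)
    show ?case
    proof
      assume "x \<in> ball a r"
      with \<psi>_in[OF this] elim show False by (simp add: f_def)
    qed
  qed
qed (simp add: ball_empty)

section \<open>Exhaustion of the half-space by caps of large balls\<close>

theorem theorem1p4:
  fixes c :: real
    and \<nu> :: "(real ^ 'n::{finite,linorder}) set \<Rightarrow> real ^ 'n::{finite,linorder}"
    and \<tau> :: "real ^ 'n::{finite,linorder} \<Rightarrow> real ^ 'n::{finite,linorder}"
  assumes "c > 0"
    and "locally_finite_vector_measure \<nu>"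
    and "polar_decomposition \<nu> \<tau>"
    and "emeasure (total_variation \<nu>) {x. x $ last_index \<le> 0} = 0"
    and "divergence_free \<nu>"
    and "AE x in total_variation \<nu>. \<tau> x $ last_index \<ge> c * norm (\<tau> x)"
  shows "\<nu> = (\<lambda>B. 0)"
proof -
  let ?M = "total_variation \<nu>" and ?k = "last_index :: 'n"
  define \<sigma> where "\<sigma> = polar_density \<nu>"
  have \<sigma>: "polar_decomposition \<nu> \<sigma>"
    unfolding \<sigma>_def polar_density_def by (rule someI[of "polar_decomposition \<nu>" \<tau>]) (rule assms(3))
  have "AE x in ?M. norm (\<tau> x) = 1" and \<sigma>_norm: "AE x in ?M. norm (\<sigma> x) = 1"
    using assms(3) \<sigma> by (auto simp: polar_decomposition_def)
  with assms(6) have "AE x in ?M. c \<le> \<tau> x $ ?k"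
    by eventually_elim simp
  then have \<sigma>_ge: "AE x in ?M. c \<le> \<sigma> x $ ?k"
    by (rule polar_decomposition_component_lower_bound[OF assms(3) \<sigma>])
  have half: "AE x in ?M. x $ ?k > 0"
  proof (rule AE_I[OF _ assms(4)])
    have "closed {x. x $ ?k \<le> (0 :: real)}"
      by (intro closed_Collect_le continuous_intros)
    then show "{x. x $ ?k \<le> 0} \<in> sets ?M" by simp
  qed (auto simp: not_less)
  txt \<open>For \<open>x $ ?k > 0\<close>, membership in the ball forces \<open>norm x < n\<close>, while \<open>(x - a n) \<bullet> \<sigma> x\<close> is
    at least \<open>2 n - norm x\<close>.\<close>
  define a where "a n = - (2 * real n / c) *\<^sub>R axis ?k (1::real)" for n
  \<comment> \<open>With this radius the square of |a n| cancels in the expanded ball condition, and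
    the sphere meets the hyperplane \<open>x $ ?k = 0\<close> in radius n about the origin.\<close>
  define \<rho> where "\<rho> n = sqrt ((2 * real n / c)\<^sup>2 + (real n)\<^sup>2)" for n
  have ball_iff: "x \<in> ball (a n) (\<rho> n) \<longleftrightarrow> (norm x)\<^sup>2 + 4 * real n / c * x $ ?k < (real n)\<^sup>2" for x n
  proof -
    have "x \<in> ball (a n) (\<rho> n) \<longleftrightarrow> (norm (x - a n))\<^sup>2 < (2 * real n / c)\<^sup>2 + (real n)\<^sup>2"
      using real_sqrt_less_iff[of "(norm (x - a n))\<^sup>2" "(2 * real n / c)\<^sup>2 + (real n)\<^sup>2"]
      unfolding \<rho>_def by (simp add: dist_norm norm_minus_commute del: real_sqrt_less_iff)
    also have "(norm (x - a n))\<^sup>2 = (norm x)\<^sup>2 + 4 * real n / c * x $ ?k + (2 * real n / c)\<^sup>2"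
      unfolding power2_norm_eq_inner a_def
      by (simp add: inner_add_left inner_add_right inner_axis inner_axis'
          power2_eq_square distrib_left add_divide_distrib)
    finally show ?thesis by auto
  qed
  have "AE x in ?M. x \<notin> ball (a n) (\<rho> n)" for n
  proof (rule divergence_free_AE_not_in_ball[OF \<sigma>[unfolded \<sigma>_def] assms(5), folded \<sigma>_def])
    from \<sigma>_ge \<sigma>_norm half
    show "AE x in ?M. x \<in> ball (a n) (\<rho> n) \<longrightarrow> (x - a n) \<bullet> \<sigma> x > 0"
    proof eventually_elim
      case (elim x)
      show ?case
      proof
        assume "x \<in> ball (a n) (\<rho> n)"
        then have "(norm x)\<^sup>2 + 4 * real n / c * x $ ?k < (real n)\<^sup>2" by (rule ball_iff[THEN iffD1])
        moreover have "0 \<le> 4 * real n / c * x $ ?k" using elim \<open>c > 0\<close> by simp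
        ultimately have "(norm x)\<^sup>2 < (real n)\<^sup>2" by linarith
        then have "norm x < real n" by (rule power_less_imp_less_base) simp
        moreover have "- norm x \<le> x \<bullet> \<sigma> x"
          using Cauchy_Schwarz_ineq2[of x "\<sigma> x"] elim by (simp add: abs_le_iff)
        \<comment> \<open>The depth 2n/c of the centre is made for this bound: times c it gives 2n,
          which outweighs the loss of at most \<open>norm x < n\<close>.\<close>
        moreover have "(2 * real n / c) * c \<le> (2 * real n / c) * \<sigma> x $ ?k"
          using elim \<open>c > 0\<close> by (intro mult_left_mono) auto
        moreover have "(x - a n) \<bullet> \<sigma> x = x \<bullet> \<sigma> x + (2 * real n / c) * \<sigma> x $ ?k"
          by (simp add: a_def inner_add_left inner_axis')
        ultimately show "(x - a n) \<bullet> \<sigma> x > 0" using \<open>c > 0\<close> norm_ge_zero[of x] by simp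
      qed
    qed
  qed
  then have "AE x in ?M. \<forall>n. x \<notin> ball (a n) (\<rho> n)"
    by (subst AE_all_countable) blast
  then have "AE x in ?M. False"
  proof eventually_elim
    case (elim x)
    \<comment> \<open>Each point lies in some ball: the left side of \<open>ball_iff\<close> grows
      at most linearly in n, the right side quadratically. The summand 1 ensures n >= 1, so that
      |x|^2 is at most n |x|^2.\<close>
    obtain n where n: "real n > (norm x)\<^sup>2 + 4 / c * \<bar>x $ ?k\<bar> + 1"
      using reals_Archimedean2 by blast
    have nonneg: "0 \<le> 4 / c * \<bar>x $ ?k\<bar>" using \<open>c > 0\<close> by simp
    have n1: "1 \<le> real n" using n nonneg zero_le_power2[of "norm x"] by linarith
    have "(norm x)\<^sup>2 + 4 * real n / c * x $ ?k \<le> (norm x)\<^sup>2 * real n + 4 / c * \<bar>x $ ?k\<bar> * real n"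
    proof (rule add_mono)
      show "(norm x)\<^sup>2 \<le> (norm x)\<^sup>2 * real n"
        using mult_left_mono[OF n1 zero_le_power2[of "norm x"]] by simp
      have "4 * real n / c * x $ ?k \<le> 4 * real n / c * \<bar>x $ ?k\<bar>"
        using \<open>c > 0\<close> by (intro mult_left_mono) auto
      then show "4 * real n / c * x $ ?k \<le> 4 / c * \<bar>x $ ?k\<bar> * real n" by (simp add: ac_simps)
    qed
    also have "\<dots> = ((norm x)\<^sup>2 + 4 / c * \<bar>x $ ?k\<bar>) * real n" by (simp add: algebra_simps)
    also have "\<dots> < real n * real n"
      using n n1 by (intro mult_strict_right_mono) linarith+
    finally have "x \<in> ball (a n) (\<rho> n)" unfolding ball_iff power2_eq_square[of "real n"] .
    with elim show ?case by blast
  qed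
  then show ?thesis by (rule polar_decomposition_eq_0[OF assms(2,3)])
qed

end
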